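(* For all positive integers $n$, the geometric generating functions $\sum_{\beta\in B_n}z^{\|\beta\|_d}$ and $\sum_{\beta\in B_n}z^{\|\beta\|_\ell}$ are equal.
   Context: Let $D^2\subseteq\mathbb{C}$ be the closed unit disk, let $p_1<\dots<p_n$ be points of $(-1,1)$ (the punctures), and let $P_n=\{p_1,\dots,p_n\}$. Let $H_n$ be the group of orientation-preserving homeomorphisms $h:\mathbb{C}\to\mathbb{C}$ such that $h(P_n)=P_n$, $h(\partial D^2)=\partial D^2$, $h(1)=1$ and $h(-1)=-1$. The braid group $B_n$ is the quotient of $H_n$ by the isotopy relation (isotopy through elements of $H_n$). The trivial lamination $\mathbf{L}$ is the union of the vertical lines $\frac12(p_j+p_{j+1})+i\mathbb{R}$, $1\le j\le n-1$. For $\beta\in B_n$, the laminated norm is $\|\beta\|_\ell:=\min\{|h(\mathbf{L})\cap[-1,1]| : h\in H_n\text{ represents }\beta\}$ and the diagrammatic norm is $\|\beta\|_d:=\min\{|h([-1,1])\cap\mathbf{L}| : h\in H_n \text{ represents }\beta\}$. The generating functions are formal power series in $z$ (there are finitely many braids of each given norm). *)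

theory Defs
  imports "HOL-Complex_Analysis.Complex_Analysis" "HOL-Library.Extended_Nat"
begin

text \<open>
  Orientation is read off from the local degree of the homeomorphism: small or large,
  every positively oriented circle around \<open>z\<close> is sent to a loop with winding number 1
  around \<open>h z\<close>. The library's \<^const>\<open>winding_number\<close> is defined for arbitrary continuous
  closed paths, so no smoothness of \<open>h\<close> is needed.
\<close>

definition orientation_preserving :: "(complex \<Rightarrow> complex) \<Rightarrow> bool" where
  "orientation_preserving h \<longleftrightarrow>
     (\<forall>z r. 0 < r \<longrightarrow> winding_number (h \<circ> circlepath z r) (h z) = 1)"

definition punctures :: "nat \<Rightarrow> (nat \<Rightarrow> real) \<Rightarrow> complex set" where
  "punctures n p = (\<lambda>j. complex_of_real (p j)) ` {1..n}"

definition braid_homeos :: "nat \<Rightarrow> (nat \<Rightarrow> real) \<Rightarrow> (complex \<Rightarrow> complex) set" where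
  "braid_homeos n p = {h. homeomorphic_map euclidean euclidean h \<and> orientation_preserving h \<and>
               h ` punctures n p = punctures n p \<and>
               h ` sphere 0 1 = sphere 0 1 \<and> h 1 = 1 \<and> h (-1) = -1}"

definition isotopy :: "nat \<Rightarrow> (nat \<Rightarrow> real) \<Rightarrow> ((complex \<Rightarrow> complex) \<times> (complex \<Rightarrow> complex)) set" where
  "isotopy n p = {(f, g). f \<in> braid_homeos n p \<and> g \<in> braid_homeos n p \<and>
                          homotopic_with (\<lambda>h. h \<in> braid_homeos n p) euclidean euclidean f g}"

lemma equiv_isotopy: "equiv (braid_homeos n p) (isotopy n p)"
proof (rule equivI)
  show "isotopy n p \<subseteq> braid_homeos n p \<times> braid_homeos n p"
    by (auto simp: isotopy_def)
  show "refl_on (braid_homeos n p) (isotopy n p)"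
    by (auto simp: refl_on_def isotopy_def braid_homeos_def homeomorphic_imp_continuous_map
             simp del: continuous_map_iff_continuous2)
  show "sym (isotopy n p)"
    by (auto simp: sym_def isotopy_def intro: homotopic_with_symD)
  show "trans (isotopy n p)"
    by (auto simp: trans_def isotopy_def intro: homotopic_with_trans)
qed

text \<open>
  A braid is an isotopy class, i.e. the set of all \<open>h \<in> braid_homeos n p\<close> representing it. Only the
  underlying set of the braid group matters for counting braids.
\<close>

definition braid_group :: "nat \<Rightarrow> (nat \<Rightarrow> real) \<Rightarrow> (complex \<Rightarrow> complex) set set" where
  "braid_group n p = braid_homeos n p // isotopy n p"

definition trivial_lamination :: "nat \<Rightarrow> (nat \<Rightarrow> real) \<Rightarrow> complex set" where
  "trivial_lamination n p = (\<Union>j\<in>{1..<n}. {z. Re z = (p j + p (j + 1)) / 2})"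

definition real_segment :: "complex set" where
  "real_segment = complex_of_real ` {-1..1}"

text \<open>
  Intersections of curves may be infinite, so they are counted in \<^typ>\<open>enat\<close>; since
  \<^typ>\<open>enat\<close> is well-ordered, the infima below are minima, and a representative with
  infinitely many intersection points never realises a finite norm.
\<close>

definition ecard :: "'a set \<Rightarrow> enat" where
  "ecard A = (if finite A then enat (card A) else \<infinity>)"

definition laminated_norm :: "nat \<Rightarrow> (nat \<Rightarrow> real) \<Rightarrow> (complex \<Rightarrow> complex) set \<Rightarrow> enat" where
  "laminated_norm n p \<beta> = (INF h\<in>\<beta>. ecard (h ` trivial_lamination n p \<inter> real_segment))"

definition diagrammatic_norm :: "nat \<Rightarrow> (nat \<Rightarrow> real) \<Rightarrow> (complex \<Rightarrow> complex) set \<Rightarrow> enat" where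
  "diagrammatic_norm n p \<beta> = (INF h\<in>\<beta>. ecard (h ` real_segment \<inter> trivial_lamination n p))"

text \<open>
  The series \<open>\<Sum>\<beta>\<in>B. z ^ \<nu> \<beta>\<close>, given by its coefficients. The lemma below confirms that it is
  the sum of that family in the usual topology of formal power series whenever only
  finitely many elements have any given (finite) norm.
\<close>

definition generating_function :: "'a set \<Rightarrow> ('a \<Rightarrow> enat) \<Rightarrow> int fps" where
  "generating_function B \<nu> = Abs_fps (\<lambda>k. int (card {\<beta> \<in> B. \<nu> \<beta> = enat k}))"

lemma has_sum_generating_function:
  assumes fin: "\<And>k. finite {\<beta> \<in> B. \<nu> \<beta> = enat k}" and "\<And>\<beta>. \<beta> \<in> B \<Longrightarrow> \<nu> \<beta> \<noteq> \<infinity>"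
  shows "((\<lambda>\<beta>. fps_X ^ the_enat (\<nu> \<beta>)) has_sum generating_function B \<nu>) B"
  unfolding has_sum_def
proof (rule tendsto_fpsI)
  fix k
  let ?S = "{\<beta> \<in> B. \<nu> \<beta> = enat k}"
  have "fps_nth (\<Sum>\<beta>\<in>F. fps_X ^ the_enat (\<nu> \<beta>)) k = fps_nth (generating_function B \<nu>) k"
    if F: "finite F" "?S \<subseteq> F" "F \<subseteq> B" for F
  proof -
    have "\<nu> \<beta> = enat k \<longleftrightarrow> k = the_enat (\<nu> \<beta>)" if "\<beta> \<in> F" for \<beta>
      using assms(2)[of \<beta>] F(3) that by (cases "\<nu> \<beta>") auto
    then have "{\<beta> \<in> F. k = the_enat (\<nu> \<beta>)} = ?S"
      using F by auto
    then show ?thesis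
      using F(1) by (simp add: fps_sum_nth fps_X_power_iff generating_function_def
          sum.If_cases Int_def)
  qed
  then show "\<forall>\<^sub>F F in finite_subsets_at_top B.
      fps_nth (\<Sum>\<beta>\<in>F. fps_X ^ the_enat (\<nu> \<beta>)) k = fps_nth (generating_function B \<nu>) k"
    unfolding eventually_finite_subsets_at_top using fin[of k] by (intro exI[of _ ?S]) auto
qed

end

theory Submission
  imports Defs
begin

text \<open>
  Since \<open>h(L) \<inter> [-1,1]\<close> and \<open>L \<inter> h\<^sup>-\<^sup>1([-1,1])\<close> are in bijection via \<open>h\<close>, the laminated norm of a
  braid is the diagrammatic norm of the inverse braid, and inversion permutes the braid group.
  The analytic content is that inversion is well defined on isotopy classes: the inverse of
  an orientation-preserving homeomorphism preserves orientation, and the fibrewise inverse of an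
  isotopy is jointly continuous.
\<close>

section \<open>Joint continuity of fibrewise inverses\<close>

text \<open>The image of a small sphere around the preimage \<open>z\<close> of \<open>w\<close> is
  compact and misses \<open>w\<close>. For \<open>s\<close> near \<open>t\<close> it still misses a
  fixed ball around \<open>w\<close>. The preimage of that ball is connected, contains
  \<open>z\<close> and avoids the sphere, so it stays inside.\<close>

lemma continuous_on_fibrewise_inverse:
  fixes H :: "'a::topological_space \<times> 'b::euclidean_space \<Rightarrow> 'b"
  assumes H: "continuous_on (T \<times> UNIV) H"
    and bij: "\<And>t. t \<in> T \<Longrightarrow> bij (\<lambda>x. H (t, x))"
    and inv: "\<And>t. t \<in> T \<Longrightarrow> continuous_on UNIV (inv (\<lambda>x. H (t, x)))"
  shows "continuous_on (T \<times> UNIV) (\<lambda>(t, y). inv (\<lambda>x. H (t, x)) y)"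
  unfolding continuous_on_def
proof (intro ballI, clarify)
  fix t w assume t: "t \<in> T"
  define G where "G s = inv (\<lambda>x. H (s, x))" for s
  have HG: "H (s, G s y) = y" and GH: "G s (H (s, x)) = x" if "s \<in> T" for s x y
    unfolding G_def using bij[OF that]
    by (simp_all add: bij_is_surj surj_f_inv_f[of "\<lambda>x. H (s, x)"] bij_is_inj inv_f_f[of "\<lambda>x. H (s, x)"])
  define z where "z = G t w"
  have w: "w = H (t, z)" by (simp add: z_def HG t)
  have "((\<lambda>(s, y). G s y) \<longlongrightarrow> z) (at (t, w) within T \<times> UNIV)"
  proof (rule tendstoI)
    fix e :: real assume e: "0 < e"
    define S where "S = sphere z (e/2)"
    have contS: "continuous_on S (\<lambda>x. H (t, x))"
      using t by (intro continuous_on_compose2[OF H] continuous_intros) auto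
    have "compact ((\<lambda>x. H (t, x)) ` S)"
      by (rule compact_continuous_image[OF contS]) (simp add: S_def)
    moreover have "w \<notin> (\<lambda>x. H (t, x)) ` S"
      using e GH[OF t] by (auto simp: w S_def) (metis GH dist_self half_gt_zero less_irrefl t)
    ultimately obtain d where d: "0 < d" "\<And>x. x \<in> S \<Longrightarrow> d \<le> dist w (H (t, x))"
      using separate_point_closed[OF compact_imp_closed] by (metis imageI)
    \<comment> \<open>Compactness of the closed ball makes the maps for \<open>s\<close> near
      \<open>t\<close> uniformly close on it.\<close>
    have HC: "continuous_on (T \<times> cball z (e/2)) H"
      by (rule continuous_on_subset[OF H]) auto
    obtain X where X: "t \<in> X" "open X"
      "\<forall>s\<in>X \<inter> T. \<forall>x\<in>cball z (e/2). dist (H (s, x)) (H (t, x)) \<le> d/3"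
      using continuous_on_prod_compactE[OF HC compact_cball t, of "d/3"] d by auto
    \<comment> \<open>The radii fit because \<open>d/3 < d/2\<close> puts \<open>H (s, z)\<close> in
      the ball, and \<open>d/3 + d/2 < d\<close> keeps the image of \<open>S\<close> out of
      it.\<close>
    have near: "dist (G s y) z < e" if s: "s \<in> X" "s \<in> T" and y: "y \<in> ball w (d/2)" for s y
    proof -
      let ?B = "ball w (d/2)"
      have "connected (G s ` ?B)"
        using inv[OF s(2)] unfolding G_def
        by (intro connected_continuous_image) (auto intro: continuous_on_subset)
      moreover have "z \<in> G s ` ?B"
      proof
        show "z = G s (H (s, z))" by (simp add: GH s)
        have "dist (H (s, z)) w \<le> d/3" using X(3) s e by (auto simp: w)
        then show "H (s, z) \<in> ?B" using d(1) by (simp add: dist_commute)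
      qed
      moreover have "G s ` ?B \<inter> frontier (ball z (e/2)) = {}"
      proof -
        have False if v: "v \<in> ?B" "G s v \<in> S" for v
        proof -
          have "dist v (H (t, G s v)) \<le> d/3"
            using X(3) s v(2) HG[OF s(2), of v] by (auto simp: S_def dest!: bspec)
          moreover have "d \<le> dist w (H (t, G s v))" using d(2) v(2) .
          moreover have "dist w v < d/2" using v(1) by simp
          ultimately show False
            using dist_triangle[of w "H (t, G s v)" v] d(1) by linarith
        qed
        moreover have "frontier (ball z (e/2)) = S" using e by (simp add: S_def)
        ultimately show ?thesis by blast
      qed
      ultimately have "G s ` ?B \<subseteq> ball z (e/2)"
        using connected_Int_frontier[of "G s ` ?B" "ball z (e/2)"] e centre_in_ball[of z "e/2"]
        by (meson Diff_eq_empty_iff disjoint_iff half_gt_zero)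
      then have "dist z (G s y) < e/2" using y by (meson image_subset_iff mem_ball)
      then show ?thesis using e by (simp add: dist_commute)
    qed
    show "\<forall>\<^sub>F x in at (t, w) within T \<times> UNIV. dist (case x of (s, y) \<Rightarrow> G s y) z < e"
      unfolding eventually_at_topological
      using near X(1,2) d(1)
      by (intro exI[of _ "X \<times> ball w (d/2)"]) (auto intro: open_Times)
  qed
  then show "((\<lambda>(t, y). inv (\<lambda>x. H (t, x)) y) \<longlongrightarrow> inv (\<lambda>x. H (t, x)) w) (at (t, w) within T \<times> UNIV)"
    by (simp add: G_def z_def)
qed

section \<open>Winding numbers, logarithmic lifts and orientation\<close>

lemma winding_number_eq_log_difference:
  assumes "path q" "\<And>t. t \<in> {0..1} \<Longrightarrow> \<gamma> t = z + exp (q t)"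
  shows "winding_number \<gamma> z = (pathfinish q - pathstart q) / (2 * of_real pi * \<i>)"
proof -
  have "winding_number \<gamma> z = winding_number (\<lambda>t. \<gamma> t - z) 0"
    by (rule winding_number_offset)
  also have "\<dots> = winding_number (exp \<circ> q) 0"
    by (rule winding_number_cong) (simp add: assms(2))
  finally show ?thesis by (simp add: winding_number_compose_exp assms(1))
qed

text \<open>The values lie in the discrete set of integer multiples of \<open>2 * pi * \<i>\<close>,
  and the plane is connected.\<close>

lemma continuous_exp_eq_1_imp_constant:
  fixes q :: "complex \<Rightarrow> complex"
  assumes q: "continuous_on UNIV q" and exp: "\<And>x. exp (q x) = 1"
  shows "q x = q y"
proof -
  have "q constant_on UNIV"
  proof (rule continuous_discrete_range_constant[OF connected_UNIV q])
    fix x :: complex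
    have "2 * pi \<le> cmod (q y - q x)" if "q y \<noteq> q x" for y
    proof (rule ccontr)
      assume "\<not> ?thesis"
      then have "\<bar>Im (q y) - Im (q x)\<bar> < 2 * pi"
        using abs_Im_le_cmod[of "q y - q x"] by simp
      then show False using exp_complex_eqI[of "q y" "q x"] exp that by auto
    qed
    then show "\<exists>e>0. \<forall>y. y \<in> UNIV \<and> q y \<noteq> q x \<longrightarrow> e \<le> cmod (q y - q x)"
      by (intro exI[of _ "2 * pi"]) auto
  qed
  then show ?thesis by (auto simp: constant_on_def)
qed

lemma homeomorphic_map_euclidean_iff:
  fixes h :: "'a::topological_space \<Rightarrow> 'b::topological_space"
  shows "homeomorphic_map euclidean euclidean h \<longleftrightarrow>
    bij h \<and> continuous_on UNIV h \<and> continuous_on UNIV (inv h)"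
proof
  assume h: "homeomorphic_map euclidean euclidean h"
  then obtain g where g: "homeomorphic_maps euclidean euclidean h g"
    unfolding homeomorphic_map_maps by blast
  then have gh: "\<And>x. g (h x) = x" "\<And>y. h (g y) = y"
    by (auto simp: homeomorphic_maps_def)
  then have "inv h = g"
    by (intro inv_equality) auto
  moreover have "bij h" using gh by (metis bijI')
  ultimately show "bij h \<and> continuous_on UNIV h \<and> continuous_on UNIV (inv h)"
    using g by (auto simp: homeomorphic_maps_def)
next
  assume "bij h \<and> continuous_on UNIV h \<and> continuous_on UNIV (inv h)"
  then show "homeomorphic_map euclidean euclidean h"
    unfolding homeomorphic_map_maps homeomorphic_maps_def
    by (intro exI[of _ "inv h"]) (auto simp: bij_is_inj bij_is_surj surj_f_inv_f)
qed

text \<open>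
  With \<open>z = h\<^sup>-\<^sup>1 w\<close>, lift \<open>h\<close> to \<open>q\<close> such that \<open>h (z + exp x) = w + exp (q x)\<close>. As \<open>h\<close> preserves
  orientation, \<open>q\<close> commutes with the translation by \<open>2 \<pi> i\<close>. If \<open>l\<close> is a lift of the preimage of a
  circle around \<open>w\<close>, then \<open>q \<circ> l\<close> is a lift of the circle, so \<open>l\<close> and \<open>q \<circ> l\<close> have the same increment.
\<close>

lemma orientation_preserving_inv:
  assumes "homeomorphic_map euclidean euclidean h" and op: "orientation_preserving h"
  shows "orientation_preserving (inv h)"
  unfolding orientation_preserving_def
proof (intro allI impI)
  fix w :: complex and r :: real assume r: "0 < r"
  define z where "z = inv h w"
  define c :: complex where "c = 2 * of_real pi * \<i>"
  have c0: "c \<noteq> 0" by (simp add: c_def)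
  have bij: "bij h" and h: "continuous_on UNIV h" and g: "continuous_on UNIV (inv h)"
    using assms(1) by (auto simp: homeomorphic_map_euclidean_iff)
  have hz: "h z = w" and hg: "\<And>y. h (inv h y) = y" and inj: "\<And>x y. h x = h y \<longleftrightarrow> x = y"
    using bij by (auto simp: z_def bij_is_surj surj_f_inv_f inj_eq bij_is_inj)
  \<comment> \<open>A logarithm exists because the plane is contractible and, \<open>h\<close> being
    injective, this function never vanishes.\<close>
  have "continuous_on UNIV (\<lambda>x. h (z + exp x) - w)"
    by (intro continuous_intros continuous_on_compose2[OF h]) auto
  moreover have "h (z + exp x) - w \<noteq> 0" for x
    using inj[of "z + exp x" z] hz by auto
  ultimately obtain q where q: "continuous_on UNIV q" and "\<And>x. h (z + exp x) - w = exp (q x)"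
    using continuous_logarithm_on_contractible[of UNIV "\<lambda>x. h (z + exp x) - w"] contractible_UNIV
    by (metis UNIV_I)
  then have hq: "h (z + exp x) = w + exp (q x)" for x
    by (metis add.commute diff_add_cancel)
  have expc: "exp (x + c) = exp x" for x
    by (simp add: c_def exp_add)
  \<comment> \<open>The segment from 0 to \<open>c\<close> lifts the unit circle around
    \<open>z\<close>, so its image under \<open>q\<close> lifts a loop of winding number 1.\<close>
  have "q c - q 0 = c"
  proof -
    have "path (\<lambda>t. q (c * of_real t))"
      unfolding path_def by (intro continuous_on_compose2[OF q] continuous_intros) auto
    then have "winding_number (h \<circ> circlepath z 1) w = (q c - q 0) / c"
      using winding_number_eq_log_difference[of "\<lambda>t. q (c * of_real t)" "h \<circ> circlepath z 1" w]
      by (simp add: hq[symmetric] circlepath c_def pathfinish_def pathstart_def)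
    then show ?thesis
      using op hz c0 unfolding orientation_preserving_def
      by (metis nonzero_divide_eq_eq mult_1 zero_less_one)
  qed
  \<comment> \<open>Both sides have the same exponential, so their difference cannot vary with
    \<open>x\<close>.\<close>
  moreover have "q (x + c) - q x = q (0 + c) - q 0" for x
  proof -
    have "exp (q (x + c)) = exp (q x)" for x
      using hq[of x] hq[of "x + c"] by (simp add: expc)
    then have "exp (q (x + c) - q x) = 1" for x by (simp add: exp_diff)
    then show ?thesis
      by (intro continuous_exp_eq_1_imp_constant[of "\<lambda>x. q (x + c) - q x"] continuous_intros
          continuous_on_compose2[OF q]) auto
  qed
  ultimately have qc: "q (x + c) = q x + c" for x
    by (simp add: algebra_simps) (metis add.commute diff_add_cancel)
  have qn: "q (x + of_nat m * c) = q x + of_nat m * c" for m :: nat and x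
  proof (induction m)
    case (Suc m)
    then show ?case using qc[of "x + of_nat m * c"] by (simp add: algebra_simps)
  qed simp
  have qk: "q (x + of_int k * c) = q x + of_int k * c" for k :: int and x
  proof (cases "0 \<le> k")
    case True
    then show ?thesis using qn[of x "nat k"] by simp
  next
    case False
    \<comment> \<open>For negative \<open>k\<close>, start from the translated point and return to
      \<open>x\<close> by a natural multiple of \<open>c\<close>.\<close>
    then show ?thesis using qn[of "x + of_int k * c" "nat (-k)"] by (simp add: algebra_simps)
  qed
  let ?\<gamma> = "inv h \<circ> circlepath w r"
  have "path ?\<gamma>"
    using g by (intro path_continuous_image) (auto intro: continuous_on_subset)
  moreover have "z \<notin> path_image ?\<gamma>"
    using r hz hg unfolding path_image_compose by (auto simp: path_image_circlepath)
  ultimately obtain l where l: "path l" "pathfinish l - pathstart l = c * winding_number ?\<gamma> z"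
      "\<And>t. t \<in> {0..1} \<Longrightarrow> ?\<gamma> t = z + exp (l t)"
    using winding_number_as_continuous_log[of ?\<gamma> z] unfolding c_def by metis
  \<comment> \<open>Integrality is what lets \<open>q\<close> commute with the increment of
    \<open>l\<close>.\<close>
  have "winding_number ?\<gamma> z \<in> \<int>"
    using \<open>path ?\<gamma>\<close> \<open>z \<notin> path_image ?\<gamma>\<close>
    by (intro integer_winding_number) (auto simp: pathfinish_compose pathstart_compose)
  then obtain k where k: "winding_number ?\<gamma> z = of_int k" by (auto elim: Ints_cases)
  have "circlepath w r t = w + exp ((q \<circ> l) t)" if "t \<in> {0..1}" for t
    using hg[of "circlepath w r t"] l(3)[OF that] by (simp add: hq)
  moreover have "path (q \<circ> l)"
    using l(1) q by (intro path_continuous_image) (auto intro: continuous_on_subset)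
  ultimately have "winding_number (circlepath w r) w = (q (pathfinish l) - q (pathstart l)) / c"
    using winding_number_eq_log_difference[of "q \<circ> l" "circlepath w r" w]
    by (simp add: c_def pathfinish_compose pathstart_compose)
  moreover have "pathfinish l = pathstart l + of_int k * c"
    using l(2) k by (simp add: algebra_simps)
  ultimately have "winding_number (circlepath w r) w = of_int k"
    using c0 by (simp add: qk)
  then show "winding_number ?\<gamma> (inv h w) = 1"
    using r k by (simp add: winding_number_circlepath_centre z_def)
qed

section \<open>Inversion of braids\<close>

lemma inv_braid_homeos:
  assumes "h \<in> braid_homeos n p"
  shows "inv h \<in> braid_homeos n p" "inv (inv h) = h"
proof -
  have h: "homeomorphic_map euclidean euclidean h" and bij: "bij h"
    using assms by (auto simp: braid_homeos_def homeomorphic_map_euclidean_iff)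
  show inv_inv: "inv (inv h) = h" by (rule inv_inv_eq[OF bij])
  have img: "inv h ` A = A" if "h ` A = A" for A
    using bij that by (metis bij_is_inj image_inv_f_f)
  have pt: "inv h x = x" if "h x = x" for x
    using bij that by (metis bij_is_inj inv_f_f)
  have "homeomorphic_map euclidean euclidean (inv h)"
    using h bij by (simp add: homeomorphic_map_euclidean_iff bij_imp_bij_inv inv_inv)
  then show "inv h \<in> braid_homeos n p"
    using assms orientation_preserving_inv[OF h] by (auto simp: braid_homeos_def img pt)
qed

text \<open>Inverting every stage of an isotopy gives an isotopy between the inverses, by joint
  continuity of the fibrewise inverse.\<close>

lemma isotopy_inv:
  assumes "(f, g) \<in> isotopy n p"
  shows "(inv f, inv g) \<in> isotopy n p"
proof -
  have f: "f \<in> braid_homeos n p" and g: "g \<in> braid_homeos n p"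
    using assms by (auto simp: isotopy_def)
  have eu: "prod_topology (top_of_set T) (euclidean :: complex topology) = top_of_set (T \<times> UNIV)"
    for T :: "real set"
    using prod_topology_subtopology_eu[of T "UNIV :: complex set"] by simp
  from assms obtain H :: "real \<times> complex \<Rightarrow> complex"
    where cont: "continuous_on ({0..1} \<times> UNIV) H"
      and H01: "\<And>x. H (0, x) = f x" "\<And>x. H (1, x) = g x"
      and H: "\<And>t. t \<in> {0..1} \<Longrightarrow> (\<lambda>x. H (t, x)) \<in> braid_homeos n p"
    unfolding isotopy_def homotopic_with_def by (auto simp: eu)
  let ?G = "\<lambda>(t, y). inv (\<lambda>x. H (t, x)) y"
  have "continuous_on ({0..1} \<times> UNIV) ?G"
    using H by (intro continuous_on_fibrewise_inverse cont)
      (auto simp: braid_homeos_def homeomorphic_map_euclidean_iff)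
  moreover have "(\<lambda>y. ?G (t, y)) \<in> braid_homeos n p" if "t \<in> {0..1}" for t
    using inv_braid_homeos(1)[OF H[OF that]] by simp
  ultimately have "homotopic_with (\<lambda>h. h \<in> braid_homeos n p) euclidean euclidean (inv f) (inv g)"
    unfolding homotopic_with_def
    by (intro exI[of _ ?G]) (auto simp: eu H01)
  then show ?thesis
    using f g by (simp add: isotopy_def inv_braid_homeos)
qed

text \<open>Inversion respects isotopy and is an involution, so it carries a class onto a whole
  class and not merely into one.\<close>

lemma inv_image_braid_class:
  assumes "\<beta> \<in> braid_group n p"
  shows "inv ` \<beta> \<in> braid_group n p" "inv ` inv ` \<beta> = \<beta>"
proof -
  from assms obtain f where f: "f \<in> braid_homeos n p" and \<beta>: "\<beta> = isotopy n p `` {f}"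
    by (auto simp: braid_group_def quotient_def)
  have inv_inv: "inv (inv h) = h" if "h \<in> \<beta>" for h
    using that by (auto simp: \<beta> isotopy_def inv_braid_homeos)
  then show "inv ` inv ` \<beta> = \<beta>" by (force simp: image_image)
  have "inv ` \<beta> = isotopy n p `` {inv f}"
  proof
    show "inv ` \<beta> \<subseteq> isotopy n p `` {inv f}"
      by (auto simp: \<beta> isotopy_inv)
    show "isotopy n p `` {inv f} \<subseteq> inv ` \<beta>"
    proof
      fix h assume "h \<in> isotopy n p `` {inv f}"
      then have fh: "(inv f, h) \<in> isotopy n p" by simp
      then have "(f, inv h) \<in> isotopy n p"
        using isotopy_inv[OF fh] inv_braid_homeos(2)[OF f] by simp
      moreover have "h = inv (inv h)"
        using fh inv_braid_homeos(2) by (auto simp: isotopy_def)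
      ultimately show "h \<in> inv ` \<beta>" by (auto simp: \<beta>)
    qed
  qed
  then show "inv ` \<beta> \<in> braid_group n p"
    using inv_braid_homeos(1)[OF f] by (auto simp: braid_group_def quotient_def)
qed

section \<open>Comparison of norms and generating functions\<close>

lemma ecard_image:
  assumes "inj_on f A"
  shows "ecard (f ` A) = ecard A"
  using assms by (simp add: ecard_def card_image finite_image_iff)

text \<open>Applying the bijection \<open>h\<close> to the intersection counted for
  \<open>inv h\<close> yields the one counted for \<open>h\<close>, so the two infima run over the
  same values.\<close>

lemma laminated_norm_inv_image:
  assumes "\<beta> \<in> braid_group n p"
  shows "laminated_norm n p (inv ` \<beta>) = diagrammatic_norm n p \<beta>"
proof -
  have "ecard (inv h ` A \<inter> B) = ecard (h ` B \<inter> A)" if "h \<in> \<beta>" for h A B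
  proof -
    have "h \<in> braid_homeos n p"
      using assms that by (auto simp: braid_group_def quotient_def isotopy_def)
    then have bij: "bij h" by (auto simp: braid_homeos_def homeomorphic_map_euclidean_iff)
    then have "h ` (inv h ` A \<inter> B) = h ` B \<inter> A"
      by (simp add: image_Int bij_is_inj image_f_inv_f bij_is_surj Int_commute)
    then show ?thesis
      using ecard_image[of h "inv h ` A \<inter> B"] bij by (metis bij_is_inj inj_on_subset subset_UNIV)
  qed
  then show ?thesis
    unfolding laminated_norm_def diagrammatic_norm_def image_image by (intro INF_cong) auto
qed

text \<open>The bijection matches the level sets of the two norms. An infinite level set is matched
  with an infinite one, and \<open>card\<close> is 0 for both.\<close>

lemma generating_function_cong_bij:
  assumes "bij_betw \<phi> B C" "\<And>\<beta>. \<beta> \<in> B \<Longrightarrow> \<mu> (\<phi> \<beta>) = \<nu> \<beta>"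
  shows "generating_function B \<nu> = generating_function C \<mu>"
proof -
  have "bij_betw \<phi> {\<beta> \<in> B. \<nu> \<beta> = enat k} {\<beta> \<in> C. \<mu> \<beta> = enat k}" for k
    using assms by (auto simp: bij_betw_def inj_on_def)
  then show ?thesis
    unfolding generating_function_def by (metis bij_betw_same_card)
qed

theorem corollary3p3:
  fixes n :: nat and p :: "nat \<Rightarrow> real"
  assumes "1 \<le> n"
    and "strict_mono_on {1..n} p"
    and "p ` {1..n} \<subseteq> {-1<..<1}"
  shows "generating_function (braid_group n p) (diagrammatic_norm n p) =
         generating_function (braid_group n p) (laminated_norm n p)"
proof (rule generating_function_cong_bij)
  show "bij_betw ((`) inv) (braid_group n p) (braid_group n p)"
    \<comment> \<open>Taking inverses elementwise is its own inverse on braid classes.\<close>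
    by (rule bij_betw_byWitness[where f' = "(`) inv"]) (auto simp: inv_image_braid_class)
qed (rule laminated_norm_inv_image)

end
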